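(* Let $n\geq 5$ be odd, let $C_n$ be the cycle with nodes $v_0,\dots,v_{n-1}$ and edges $i=v_iv_{(i+1)\bmod n}$ for $0\leq i<n$, and let $S=\{\{v,w\}: v\neq w,\ vw\notin E(C_n)\}$. Then the inequality $\sum_{e\in E(C_n)}x_e\geq\lceil n/2\rceil$ defines a shared facet of $\mathrm{MultC}(C_n,S)$.
   Context: Given a graph $G=(V,E)$ and $S\subseteq\binom{V}{2}$, an ($S$-)multicut is a set $\delta\subseteq E$ such that for every $\{s,t\}\in S$ the nodes $s$ and $t$ lie in different components of $G-\delta$. For $F\subseteq E$, $x^F\in\mathbb{R}^E$ is its incidence vector. The multicut polytope is $\mathrm{MultC}^{\square}(G,S)=\mathrm{conv}\{x^\delta:\delta\text{ an } S\text{-multicut}\}$ and the multicut dominant is $\mathrm{MultC}(G,S)=\mathrm{MultC}^{\square}(G,S)+\mathbb{R}^E_{\geq 0}$. A facet-defining inequality of $\mathrm{MultC}(G,S)$ defines a shared facet if it is also facet-defining for $\mathrm{MultC}^{\square}(G,S)$. *)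

theory Defs
  imports "HOL-Analysis.Analysis"
begin

text \<open>
  A graph \<open>G = (V, E)\<close> is given by a node set \<open>V :: 'v set\<close> and a set \<open>E :: 'v set set\<close> of
  two-element subsets of \<open>V\<close>.  The space of real vectors indexed by \<open>E\<close> is realised as the
  coordinate subspace \<open>edge_space E\<close> of \<open>real ^ 'v set\<close> in which all coordinates outside \<open>E\<close>
  vanish.  The notions \<open>convex hull\<close>, \<open>aff_dim\<close> and \<open>facet_of\<close> are intrinsic, so they do not
  depend on the ambient space.
\<close>

definition edge_space :: "'v set set \<Rightarrow> (real ^ ('v::finite set)) set" where
  "edge_space E = {x. \<forall>e. e \<notin> E \<longrightarrow> x $ e = 0}"

definition nonneg_orthant :: "'v set set \<Rightarrow> (real ^ ('v::finite set)) set" where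
  "nonneg_orthant E = {x \<in> edge_space E. \<forall>e\<in>E. 0 \<le> x $ e}"

definition incidence_vector :: "'v set set \<Rightarrow> real ^ ('v::finite set)" where
  "incidence_vector F = (\<chi> e. if e \<in> F then 1 else 0)"

definition component_of_node :: "'v set \<Rightarrow> 'v set set \<Rightarrow> 'v \<Rightarrow> 'v set" where
  "component_of_node V F u =
     {w \<in> V. (u, w) \<in> {(a, b). a \<in> V \<and> b \<in> V \<and> {a, b} \<in> F}\<^sup>*}"

definition multicut :: "'v set \<Rightarrow> 'v set set \<Rightarrow> 'v set set \<Rightarrow> 'v set set \<Rightarrow> bool" where
  "multicut V E S \<delta> \<longleftrightarrow>
     \<delta> \<subseteq> E \<and>
     (\<forall>s t. {s, t} \<in> S \<longrightarrow> component_of_node V (E - \<delta>) s \<noteq> component_of_node V (E - \<delta>) t)"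

definition multicut_polytope ::
    "'v set \<Rightarrow> 'v set set \<Rightarrow> 'v set set \<Rightarrow> (real ^ ('v::finite set)) set" where
  "multicut_polytope V E S = convex hull {incidence_vector \<delta> | \<delta>. multicut V E S \<delta>}"

definition multicut_dominant ::
    "'v set \<Rightarrow> 'v set set \<Rightarrow> 'v set set \<Rightarrow> (real ^ ('v::finite set)) set" where
  "multicut_dominant V E S =
     {x + y | x y. x \<in> multicut_polytope V E S \<and> y \<in> nonneg_orthant E}"

text \<open>The inequality \<open>f x \<ge> \<beta>\<close> with linear left-hand side \<open>f\<close> is facet-defining for \<open>P\<close>.\<close>

definition facet_defining :: "('a::euclidean_space) set \<Rightarrow> ('a \<Rightarrow> real) \<Rightarrow> real \<Rightarrow> bool" where
  "facet_defining P f \<beta> \<longleftrightarrow>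
     linear f \<and> (\<forall>x\<in>P. f x \<ge> \<beta>) \<and> {x \<in> P. f x = \<beta>} facet_of P"

definition defines_shared_facet ::
    "'v set \<Rightarrow> 'v set set \<Rightarrow> 'v set set \<Rightarrow> (real ^ ('v::finite set) \<Rightarrow> real) \<Rightarrow> real \<Rightarrow> bool" where
  "defines_shared_facet V E S f \<beta> \<longleftrightarrow>
     facet_defining (multicut_dominant V E S) f \<beta> \<and>
     facet_defining (multicut_polytope V E S) f \<beta>"

text \<open>The cycle with nodes \<open>v 0, \<dots>, v (n - 1)\<close>; it is meant for \<open>n \<ge> 3\<close> and \<open>v\<close> injective
  on \<open>{0..<n}\<close>.\<close>

definition cycle_nodes :: "nat \<Rightarrow> (nat \<Rightarrow> 'v) \<Rightarrow> 'v set" where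
  "cycle_nodes n v = v ` {0..<n}"

definition cycle_edges :: "nat \<Rightarrow> (nat \<Rightarrow> 'v) \<Rightarrow> 'v set set" where
  "cycle_edges n v = {{v i, v ((i + 1) mod n)} | i. i < n}"

definition nonadjacent_pairs :: "'v set \<Rightarrow> 'v set set \<Rightarrow> 'v set set" where
  "nonadjacent_pairs V E = {{a, b} | a b. a \<in> V \<and> b \<in> V \<and> a \<noteq> b \<and> {a, b} \<notin> E}"

end

theory Submission
  imports Defs
begin

text \<open>
  A set \<open>\<delta>\<close> of edges is a multicut iff it meets every pair of consecutive edges, so that summing
  over all such pairs gives \<open>2 |\<delta>| \<ge> n\<close>, and the bound follows by rounding.  For \<open>n = 2k + 1\<close>,
  the sets \<open>D i = {i, i + 2, \<dots>, i + 2k}\<close> (modulo \<open>n\<close>) are multicuts attaining the bound, and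
  \<open>D i\<close> and \<open>D (i + 2)\<close> differ only in the consecutive edges \<open>i\<close> and \<open>i + 1\<close>.  Hence the incidence
  vectors of the \<open>D i\<close> span the whole edge space, which makes the face they lie in a facet of both
  polyhedra.
\<close>

section \<open>Facets from a spanning face\<close>

text \<open>A supporting hyperplane cuts out a face, and the point \<open>y\<close> off it makes its
  dimension drop. The drop is only one: adjoining the origin to the face raises its affine dimension
  by at most one, and the result already spans \<open>P\<close>.\<close>

lemma facet_definingI:
  fixes P :: "'a::euclidean_space set"
  assumes "convex P" and "linear f" and ge: "\<And>x. x \<in> P \<Longrightarrow> f x \<ge> \<beta>"
    and proper: "y \<in> P" "f y > \<beta>" and ne: "{x \<in> P. f x = \<beta>} \<noteq> {}"
    and span: "P \<subseteq> span {x \<in> P. f x = \<beta>}"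
  shows "facet_defining P f \<beta>"
proof -
  let ?F = "{x \<in> P. f x = \<beta>}"
  \<comment> \<open>The vector representing \<open>f\<close> as an inner product, the form in which
    supporting hyperplanes are given.\<close>
  define a where "a = adjoint f 1"
  have fa: "f x = a \<bullet> x" for x
    using adjoint_works[OF \<open>linear f\<close>, of x 1] by (simp add: a_def inner_commute)
  have "P \<inter> {x. a \<bullet> x = \<beta>} face_of P"
    using ge by (intro face_of_Int_supporting_hyperplane_ge \<open>convex P\<close>) (simp add: fa)
  also have "P \<inter> {x. a \<bullet> x = \<beta>} = ?F"
    by (auto simp: fa)
  finally have face: "?F face_of P" .
  have lt: "aff_dim ?F < aff_dim P"
    using proper by (intro face_of_aff_dim_lt face \<open>convex P\<close>) auto
  have "aff_dim P \<le> aff_dim (span ?F)"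
    by (rule aff_dim_subset[OF span])
  also have "\<dots> = int (dim ?F)"
    by (simp add: aff_dim_subspace)
  also have "\<dots> = aff_dim (insert 0 ?F)"
    by (subst aff_dim_zero) (auto intro: hull_inc simp: dim_insert span_zero)
  also have "\<dots> \<le> aff_dim ?F + 1"
    by (simp add: aff_dim_insert)
  finally have "aff_dim ?F = aff_dim P - 1"
    using lt by linarith
  then show ?thesis
    using face ne ge \<open>linear f\<close> by (auto simp: facet_defining_def facet_of_def)
qed

section \<open>Edge space, polytope and dominant\<close>

lemma edge_space_subset_span_axis:
  "edge_space E \<subseteq> span ((\<lambda>e. axis e 1) ` E)"
proof
  fix x assume x: "x \<in> edge_space E"
  have "x = (\<Sum>e\<in>E. x $ e *\<^sub>R axis e 1)"
    using x by (auto simp: vec_eq_iff edge_space_def axis_def if_distrib cong: if_cong)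
  moreover have "(\<Sum>e\<in>E. x $ e *\<^sub>R axis e 1) \<in> span ((\<lambda>e. axis e (1::real)) ` E)"
    by (intro span_sum span_scale span_base) auto
  ultimately show "x \<in> span ((\<lambda>e. axis e 1) ` E)" by simp
qed

lemma subspace_edge_space: "subspace (edge_space E)"
  by (auto simp: subspace_def edge_space_def)

lemma incidence_vector_eq_sum: "incidence_vector F = (\<Sum>e\<in>F. axis e 1)"
  by (auto simp: vec_eq_iff incidence_vector_def axis_def)

lemma sum_incidence_vector:
  assumes "F \<subseteq> E"
  shows "(\<Sum>e\<in>E. incidence_vector F $ e) = real (card F)"
proof -
  have "(\<Sum>e\<in>E. incidence_vector F $ e) = (\<Sum>e\<in>F. 1)"
    unfolding incidence_vector_def using assms
    by (intro sum.mono_neutral_cong_right) auto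
  then show ?thesis by simp
qed

lemma linear_sum_nth: "linear (\<lambda>x :: real ^ 'b. \<Sum>e\<in>E. x $ e)"
  by (intro linearI) (simp_all add: sum.distrib sum_distrib_left)

lemma zero_in_nonneg_orthant: "0 \<in> nonneg_orthant E"
  by (simp add: nonneg_orthant_def edge_space_def)

lemma convex_nonneg_orthant: "convex (nonneg_orthant E)"
  by (auto simp: convex_def nonneg_orthant_def edge_space_def)

lemma multicut_dominant_eq_set_sum:
  "multicut_dominant V E S =
    (\<Union>x\<in>multicut_polytope V E S. \<Union>y\<in>nonneg_orthant E. {x + y})"
  by (auto simp: multicut_dominant_def)

lemma convex_multicut_polytope: "convex (multicut_polytope V E S)"
  by (simp add: multicut_polytope_def)

lemma convex_multicut_dominant: "convex (multicut_dominant V E S)"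
  unfolding multicut_dominant_eq_set_sum
  by (intro convex_sums convex_multicut_polytope convex_nonneg_orthant)

lemma incidence_vector_in_multicut_polytope:
  "multicut V E S \<delta> \<Longrightarrow> incidence_vector \<delta> \<in> multicut_polytope V E S"
  by (auto simp: multicut_polytope_def intro: hull_inc)

lemma multicut_polytope_subset_dominant: "multicut_polytope V E S \<subseteq> multicut_dominant V E S"
  unfolding multicut_dominant_def using zero_in_nonneg_orthant
  by (force intro: exI[of _ 0])

lemma multicut_dominant_subset_edge_space: "multicut_dominant V E S \<subseteq> edge_space E"
proof -
  have "multicut_polytope V E S \<subseteq> edge_space E"
    unfolding multicut_polytope_def
    by (intro hull_minimal subspace_imp_convex subspace_edge_space)
       (auto simp: multicut_def edge_space_def incidence_vector_def)
  then show ?thesis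
    by (auto simp: multicut_dominant_def nonneg_orthant_def intro!: subspace_add subspace_edge_space)
qed

text \<open>The half-space is convex, so on the polytope only incidence vectors need checking; a
  summand from the orthant can only increase the total.\<close>

lemma multicut_dominant_sum_ge:
  assumes "\<And>\<delta>. multicut V E S \<delta> \<Longrightarrow> \<beta> \<le> real (card \<delta>)" and "z \<in> multicut_dominant V E S"
  shows "\<beta> \<le> (\<Sum>e\<in>E. z $ e)"
proof -
  obtain x y where z: "z = x + y" and x: "x \<in> multicut_polytope V E S" and y: "y \<in> nonneg_orthant E"
    using assms(2) by (auto simp: multicut_dominant_def)
  have "multicut_polytope V E S \<subseteq> {x. \<beta> \<le> (\<Sum>e\<in>E. x $ e)}"
    unfolding multicut_polytope_def
  proof (intro hull_minimal)
    show "convex {x. \<beta> \<le> (\<Sum>e\<in>E. (x :: real ^ 'a set) $ e)}"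
      using convex_linear_vimage[OF linear_sum_nth, of "{\<beta>..}"] by (simp add: vimage_def)
  qed (auto simp: sum_incidence_vector assms(1) multicut_def)
  moreover have "0 \<le> (\<Sum>e\<in>E. y $ e)"
    using y by (auto simp: nonneg_orthant_def intro: sum_nonneg)
  ultimately show ?thesis
    using x z by (auto simp: sum.distrib)
qed

section \<open>Separation of nodes as unreachability\<close>

lemma component_of_node_eq_iff:
  assumes "s \<in> V" "t \<in> V"
  shows "component_of_node V F s = component_of_node V F t \<longleftrightarrow>
    (s, t) \<in> {(a, b). a \<in> V \<and> b \<in> V \<and> {a, b} \<in> F}\<^sup>*" (is "_ \<longleftrightarrow> _ \<in> ?R\<^sup>*")
proof
  assume "component_of_node V F s = component_of_node V F t"
  moreover have "t \<in> component_of_node V F t"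
    using assms by (simp add: component_of_node_def)
  ultimately show "(s, t) \<in> ?R\<^sup>*" by (auto simp: component_of_node_def)
next
  assume st: "(s, t) \<in> ?R\<^sup>*"
  have "sym ?R" by (auto simp: sym_def insert_commute)
  then have "(t, s) \<in> ?R\<^sup>*" using st by (meson sym_rtrancl symD)
  with st show "component_of_node V F s = component_of_node V F t"
    by (auto simp: component_of_node_def intro: rtrancl_trans)
qed

lemma multicut_nonadjacent_iff:
  "multicut V E (nonadjacent_pairs V E) \<delta> \<longleftrightarrow> \<delta> \<subseteq> E \<and>
    (\<forall>s\<in>V. \<forall>t\<in>V. s \<noteq> t \<longrightarrow> {s, t} \<notin> E \<longrightarrow>
      (s, t) \<notin> {(a, b). a \<in> V \<and> b \<in> V \<and> {a, b} \<in> E - \<delta>}\<^sup>*)"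
proof -
  have "{s, t} \<in> nonadjacent_pairs V E \<longleftrightarrow> s \<in> V \<and> t \<in> V \<and> s \<noteq> t \<and> {s, t} \<notin> E" for s t
    unfolding nonadjacent_pairs_def by (auto simp: doubleton_eq_iff insert_commute)
  then show ?thesis
    unfolding multicut_def by (auto simp: component_of_node_eq_iff)
qed

section \<open>Nodes and edges of the cycle, indexed modulo n\<close>

locale cycle_graph =
  fixes n :: nat and v :: "nat \<Rightarrow> 'v::finite"
  assumes n_ge_5: "n \<ge> 5" and inj_v: "inj_on v {0..<n}"
begin

abbreviation "V \<equiv> cycle_nodes n v"
abbreviation "E \<equiv> cycle_edges n v"
abbreviation "S \<equiv> nonadjacent_pairs V E"

text \<open>Indices range over all naturals and are reduced modulo \<open>n\<close>, so successors
  and shifts need no separate wrap-around case.\<close>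

definition node :: "nat \<Rightarrow> 'v" where "node i = v (i mod n)"
definition edge :: "nat \<Rightarrow> 'v set" where "edge i = {node i, node (Suc i)}"

lemma node_eq_iff: "node i = node j \<longleftrightarrow> i mod n = j mod n"
  using inj_v n_ge_5 by (auto simp: node_def inj_on_def)

lemma edge_mod: "edge (i mod n) = edge i"
  by (simp add: edge_def node_def mod_Suc_eq)

lemma edge_add_n: "edge (i + n) = edge i"
  by (metis edge_mod mod_add_self2)

lemma edge_eq_iff: "edge i = edge j \<longleftrightarrow> i mod n = j mod n"
proof
  assume "edge i = edge j"
  \<comment> \<open>With reduced indices, \<open>mod_Suc\<close> splits into finitely many cases.
    Matching the endpoints in reversed order would force \<open>n\<close> to divide 2.\<close>
  then have "edge (i mod n) = edge (j mod n)" by (simp add: edge_mod)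
  moreover have "i mod n < n" "j mod n < n" using n_ge_5 by auto
  ultimately show "i mod n = j mod n"
    using n_ge_5 by (auto simp: edge_def doubleton_eq_iff node_eq_iff mod_Suc split: if_splits)
qed (metis edge_mod)

lemma node_in_V: "node i \<in> V"
  using n_ge_5 by (auto simp: node_def cycle_nodes_def)

lemma E_eq: "E = edge ` {..<n}"
  by (auto simp: cycle_edges_def edge_def node_def)

lemma edge_in_E: "edge i \<in> E"
  using edge_mod[of i] n_ge_5 unfolding E_eq
  by (metis imageI lessThan_iff mod_less_divisor not_numeral_le_zero gr0I)

lemma inj_on_edge: "inj_on edge {..<n}"
  by (auto simp: inj_on_def edge_eq_iff)

lemma card_E: "card E = n"
  by (simp add: E_eq card_image inj_on_edge)

lemma edge_shared_node:
  assumes "y \<in> edge a" "y \<in> edge b"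
  shows "edge a = edge b \<or> edge a = edge (Suc b) \<or> edge b = edge (Suc a)"
proof -
  have "Suc a mod n = Suc b mod n \<Longrightarrow> a mod n = b mod n"
    using n_ge_5 by (auto simp: mod_Suc split: if_splits)
  moreover have "node a = node b \<or> node a = node (Suc b) \<or> node (Suc a) = node b
      \<or> node (Suc a) = node (Suc b)"
    using assms by (auto simp: edge_def)
  ultimately show ?thesis by (auto simp: edge_eq_iff node_eq_iff)
qed

text \<open>Shifting an index by \<open>c\<close> with \<open>0 < c < n\<close> changes the node.
  This is applied with \<open>c = 2\<close> and, were the pair an edge, with \<open>c = 1\<close> or
  \<open>c = 3\<close> according to the order in which the endpoints match.\<close>

lemma node_add_2_nonadjacent: "node m \<noteq> node (Suc (Suc m))" "{node m, node (Suc (Suc m))} \<notin> E"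
proof -
  have *: "node i \<noteq> node (i + c)" if "0 < c" "c < n" for i c
  proof
    assume "node i = node (i + c)"
    then have "(i + c) mod n = i mod n" by (simp add: node_eq_iff)
    then have "n dvd c" by (metis add_diff_cancel_left' le_add1 mod_eq_dvd_iff_nat)
    with that show False by (auto dest: dvd_imp_le)
  qed
  show "node m \<noteq> node (Suc (Suc m))"
    using *[of 2 m] n_ge_5 by simp
  show "{node m, node (Suc (Suc m))} \<notin> E"
  proof
    assume "{node m, node (Suc (Suc m))} \<in> E"
    then obtain i where "{node m, node (Suc (Suc m))} = edge i" by (auto simp: E_eq)
    then consider "node m = node i" "node (Suc (Suc m)) = node (Suc i)"
      | "node m = node (Suc i)" "node (Suc (Suc m)) = node i"
      by (auto simp: edge_def doubleton_eq_iff)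
    then show False
    proof cases
      case 1
      then have "node (Suc (Suc m)) = node (Suc m)"
        by (metis mod_Suc_eq node_eq_iff)
      then show False using *[of 1 "Suc m"] n_ge_5 by simp
    next
      case 2
      then have "node m = node (m + 3)"
        by (metis mod_Suc_eq node_eq_iff add_Suc_right add_0_right numeral_3_eq_3)
      then show False using *[of 3 m] n_ge_5 by simp
    qed
  qed
qed

section \<open>Multicuts of the cycle and their size\<close>

text \<open>Two consecutive uncut edges would connect the nonadjacent nodes \<open>m\<close> and
  \<open>m + 2\<close>. Conversely, if no two consecutive edges survive, the surviving edges form a
  matching, so connected distinct nodes are adjacent.\<close>

lemma multicut_iff:
  "multicut V E S \<delta> \<longleftrightarrow> \<delta> \<subseteq> E \<and> (\<forall>m. edge m \<in> \<delta> \<or> edge (Suc m) \<in> \<delta>)"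
proof (intro iffI conjI allI)
  assume mc: "multicut V E S \<delta>"
  then show "\<delta> \<subseteq> E" by (simp add: multicut_def)
  fix m
  let ?R = "{(a, b). a \<in> V \<and> b \<in> V \<and> {a, b} \<in> E - \<delta>}"
  show "edge m \<in> \<delta> \<or> edge (Suc m) \<in> \<delta>"
  proof (rule ccontr)
    assume "\<not> ?thesis"
    then have "(node m, node (Suc m)) \<in> ?R" "(node (Suc m), node (Suc (Suc m))) \<in> ?R"
      using edge_in_E[of m] edge_in_E[of "Suc m"] by (auto simp: edge_def node_in_V)
    then have "(node m, node (Suc (Suc m))) \<in> ?R\<^sup>*"
      by (meson r_into_rtrancl rtrancl.rtrancl_into_rtrancl)
    with mc show False
      using node_in_V node_add_2_nonadjacent unfolding multicut_nonadjacent_iff by blast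
  qed
next
  assume asm: "\<delta> \<subseteq> E \<and> (\<forall>m. edge m \<in> \<delta> \<or> edge (Suc m) \<in> \<delta>)"
  let ?R = "{(a, b). a \<in> V \<and> b \<in> V \<and> {a, b} \<in> E - \<delta>}"
  have matching: "e = e'" if "e \<in> E - \<delta>" "e' \<in> E - \<delta>" "y \<in> e" "y \<in> e'" for e e' y
  proof -
    obtain a b where "e = edge a" "e' = edge b" using \<open>e \<in> E - \<delta>\<close> \<open>e' \<in> E - \<delta>\<close> by (auto simp: E_eq)
    then show ?thesis using that asm edge_shared_node[of y a b] by auto
  qed
  \<comment> \<open>A walk in a matching never leaves its first edge: if it has reached
    \<open>y\<close> from \<open>s\<close> along one edge, the next edge shares \<open>y\<close>
    with it and hence leads back to \<open>s\<close>.\<close>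
  have "s = t \<or> {s, t} \<in> E - \<delta>" if "(s, t) \<in> ?R\<^sup>*" for s t
    using that
  proof (induction rule: rtrancl_induct)
    case (step y z)
    then have yz: "{y, z} \<in> E - \<delta>" by auto
    show ?case
    proof (cases "s = y")
      case False
      with step.IH have "{s, y} \<in> E - \<delta>" by auto
      then have "{s, y} = {y, z}" using yz by (rule matching[where y = y]) auto
      with False show ?thesis by (auto simp: doubleton_eq_iff)
    next
      case True
      with yz show ?thesis by simp
    qed
  qed simp
  then show "multicut V E S \<delta>"
    using asm unfolding multicut_nonadjacent_iff by blast
qed

lemma multicut_card_ge:
  assumes "multicut V E S \<delta>"
  shows "n \<le> 2 * card \<delta>"
proof -
  define g where "g i = (if edge i \<in> \<delta> then 1 else 0 :: nat)" for i
  have "\<delta> \<subseteq> E" using assms by (simp add: multicut_def)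
  then have "(\<Sum>e\<in>E. if e \<in> \<delta> then 1 else 0) = card \<delta>"
    by (simp add: sum.If_cases Int_absorb1)
  then have card: "(\<Sum>i<n. g i) = card \<delta>"
    by (simp add: E_eq sum.reindex[OF inj_on_edge] g_def)
  \<comment> \<open>Edge \<open>n\<close> is edge 0, so the shifted sum runs over the same edges and
    each is counted twice.\<close>
  have "g n = g 0" using edge_add_n[of 0] by (simp add: g_def)
  then have shift: "(\<Sum>i<n. g (Suc i)) = (\<Sum>i<n. g i)"
    using sum.lessThan_Suc_shift[of g n] by simp
  have "n = (\<Sum>i<n. 1)" by simp
  also have "\<dots> \<le> (\<Sum>i<n. g i + g (Suc i))"
    using assms by (intro sum_mono) (auto simp: multicut_iff g_def)
  also have "\<dots> = 2 * card \<delta>"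
    by (simp add: sum.distrib shift card)
  finally show ?thesis .
qed

section \<open>Minimum multicuts and their span\<close>

text \<open>The set \<open>D i\<close> from the overview. For \<open>n = 2k + 1\<close> its last
  index \<open>i + 2k\<close> is congruent to \<open>i - 1\<close>, so its first and last edges are
  consecutive.\<close>

definition alternating :: "nat \<Rightarrow> 'v set set" where
  "alternating i = (\<lambda>j. edge (i + 2 * j)) ` {..n div 2}"

context
  assumes odd_n: "odd n"
begin

text \<open>Distinct indices differ by a positive number of at most
  \<open>2 * (n div 2) = n - 1\<close>, which \<open>n\<close> cannot divide.\<close>

lemma inj_on_alternating: "inj_on (\<lambda>j. edge (i + 2 * j)) {..n div 2}"
proof (rule linorder_inj_onI)
  fix x y assume xy: "x < y" "x \<in> {..n div 2}" "y \<in> {..n div 2}"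
  show "edge (i + 2 * x) \<noteq> edge (i + 2 * y)"
  proof
    assume "edge (i + 2 * x) = edge (i + 2 * y)"
    then have "n dvd (i + 2 * y) - (i + 2 * x)"
      using xy by (metis add_le_cancel_left edge_eq_iff less_imp_le mod_eq_dvd_iff_nat
          mult_le_mono2)
    moreover have "0 < (i + 2 * y) - (i + 2 * x)" "(i + 2 * y) - (i + 2 * x) < n"
      using xy odd_n by (auto elim!: oddE)
    ultimately show False by (auto dest: dvd_imp_le)
  qed
qed auto

lemma card_alternating: "card (alternating i) = Suc (n div 2)"
  by (simp add: alternating_def card_image inj_on_alternating)

lemma multicut_alternating: "multicut V E S (alternating i)"
  unfolding multicut_iff
proof (intro conjI allI)
  show "alternating i \<subseteq> E" by (auto simp: alternating_def edge_in_E)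
  fix m
  text \<open>The residue of \<open>m - i\<close> modulo \<open>n\<close>, written without truncated subtraction of \<open>i\<close>.\<close>
  define t where "t = (m + i * (n - 1)) mod n"
  have "t < n" using n_ge_5 by (simp add: t_def)
  have "(i + t) mod n = (i + (m + i * (n - 1))) mod n"
    by (simp add: t_def mod_add_right_eq)
  also have "i + (m + i * (n - 1)) = m + i * n"
    using n_ge_5 by (cases n) simp_all
  finally have m: "(i + t) mod n = m mod n" by simp
  then have e: "edge m = edge (i + t)" "edge (Suc m) = edge (i + Suc t)"
    by (auto simp: edge_eq_iff) (metis mod_Suc_eq)
  show "edge m \<in> alternating i \<or> edge (Suc m) \<in> alternating i"
  \<comment> \<open>The edge at even distance from \<open>i\<close> is the chosen one. For odd
    \<open>t\<close> it is the second; as \<open>n\<close> is odd too, \<open>Suc t\<close> is still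
    at most \<open>n - 1\<close>.\<close>
  proof (cases "even t")
    case True
    then have "t = 2 * (t div 2)" "t div 2 \<le> n div 2"
      using \<open>t < n\<close> by (auto simp: div_le_mono)
    then show ?thesis unfolding e alternating_def by (metis atMost_iff image_eqI)
  next
    case False
    then have "Suc t = 2 * (Suc t div 2)" "Suc t div 2 \<le> n div 2"
      using \<open>t < n\<close> odd_n by (auto elim!: oddE)
    then show ?thesis unfolding e alternating_def by (metis atMost_iff image_eqI)
  qed
qed

lemma incidence_vector_alternating:
  "incidence_vector (alternating i) = (\<Sum>j\<le>n div 2. axis (edge (i + 2 * j)) 1)"
  by (simp add: incidence_vector_eq_sum alternating_def sum.reindex[OF inj_on_alternating])

lemma incidence_vector_alternating_diff:
  "incidence_vector (alternating i) - incidence_vector (alternating (i + 2)) =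
    axis (edge i) 1 - axis (edge (Suc i)) 1"
proof -
  let ?a = "\<lambda>j. axis (edge (i + 2 * j)) (1::real)"
  \<comment> \<open>Passing from \<open>i\<close> to \<open>i + 2\<close> shifts \<open>j\<close> by
    one, so the difference telescopes; the index just past the end wraps around to edge
    \<open>Suc i\<close>.\<close>
  have "i + 2 * Suc (n div 2) = Suc i + n"
    using odd_n by (auto elim!: oddE)
  then have "?a (Suc (n div 2)) = axis (edge (Suc i)) 1"
    by (simp only: edge_add_n)
  moreover have "(\<Sum>j\<le>n div 2. ?a j - ?a (Suc j)) = ?a 0 - ?a (Suc (n div 2))"
    by (rule sum_telescope)
  ultimately show ?thesis
    by (simp add: incidence_vector_alternating sum_subtractf)
qed

lemma edge_space_subset_span_alternating:
  "edge_space E \<subseteq> span (range (\<lambda>i. incidence_vector (alternating i)))" (is "_ \<subseteq> ?U")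
proof -
  let ?a = "\<lambda>i. axis (edge i) (1::real)"
  have inc: "incidence_vector (alternating i) \<in> ?U" for i
    by (rule span_base) auto
  have "?a 0 - ?a i \<in> ?U" for i
  proof (induction i)
    case (Suc i)
    have "?a i - ?a (Suc i) \<in> ?U"
      unfolding incidence_vector_alternating_diff[symmetric] by (intro span_diff inc)
    from span_add[OF Suc this] show ?case by simp
  qed (simp add: span_zero)
  then have diff: "?a i - ?a j \<in> ?U" for i j
    using span_diff[of "?a 0 - ?a j" _ "?a 0 - ?a i"] by simp
  have "?a i \<in> ?U" for i
  proof -
    \<comment> \<open>The differences exchange every summand of the incidence vector for
      \<open>?a i\<close>, leaving a nonzero multiple of \<open>?a i\<close>, which is then divided
      out.\<close>
    have "incidence_vector (alternating 0) + (\<Sum>j\<le>n div 2. ?a i - ?a (2 * j)) =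
        real (Suc (n div 2)) *\<^sub>R ?a i"
      by (simp add: incidence_vector_alternating sum_subtractf sum_constant_scaleR
          del: sum_constant of_nat_Suc)
    moreover have "incidence_vector (alternating 0) + (\<Sum>j\<le>n div 2. ?a i - ?a (2 * j)) \<in> ?U"
      by (intro span_add inc span_sum diff)
    ultimately have "real (Suc (n div 2)) *\<^sub>R ?a i \<in> ?U" by simp
    then have "inverse (real (Suc (n div 2))) *\<^sub>R real (Suc (n div 2)) *\<^sub>R ?a i \<in> ?U"
      by (rule span_scale)
    then show ?thesis by (simp del: of_nat_Suc)
  qed
  then have "span ((\<lambda>e. axis e 1) ` E) \<subseteq> ?U"
    by (intro span_minimal) (auto simp: E_eq)
  then show ?thesis using edge_space_subset_span_axis by blast
qed

section \<open>The shared facet\<close>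

text \<open>Treats both polyhedra at once: validity is inherited from the dominant, while the points
  spanning the face already lie in the polytope.\<close>

lemma facet_defining_between:
  assumes "convex P" "multicut_polytope V E S \<subseteq> P" "P \<subseteq> multicut_dominant V E S"
  shows "facet_defining P (\<lambda>x. \<Sum>e\<in>E. x $ e) (real (Suc (n div 2)))"
proof (rule facet_definingI)
  let ?F = "{x \<in> P. (\<Sum>e\<in>E. x $ e) = real (Suc (n div 2))}"
  have inP: "incidence_vector \<delta> \<in> P" if "multicut V E S \<delta>" for \<delta>
    using incidence_vector_in_multicut_polytope[OF that] assms by blast
  have alt: "incidence_vector (alternating i) \<in> ?F" for i
  proof -
    have "alternating i \<subseteq> E" using multicut_alternating[of i] by (simp add: multicut_def)
    then show ?thesis
      using inP[OF multicut_alternating] by (simp add: sum_incidence_vector card_alternating)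
  qed
  then show "?F \<noteq> {}" by blast
  have "P \<subseteq> edge_space E"
    using assms multicut_dominant_subset_edge_space by blast
  also have "\<dots> \<subseteq> span (range (\<lambda>i. incidence_vector (alternating i)))"
    by (rule edge_space_subset_span_alternating)
  also have "\<dots> \<subseteq> span ?F"
    using alt by (intro span_mono) blast
  finally show "P \<subseteq> span ?F" .
  show "real (Suc (n div 2)) \<le> (\<Sum>e\<in>E. x $ e)" if "x \<in> P" for x
  proof (rule multicut_dominant_sum_ge)
    show "real (Suc (n div 2)) \<le> real (card \<delta>)" if "multicut V E S \<delta>" for \<delta>
    proof -
      \<comment> \<open>Integrality rounds the bound: \<open>2 * card \<delta>\<close> is even and
        at least the odd number \<open>n\<close>.\<close>
      have "Suc (n div 2) \<le> card \<delta>" using multicut_card_ge[OF that] odd_n by (auto elim!: oddE)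
      then show ?thesis by (simp only: of_nat_le_iff)
    qed
  qed (use that assms in blast)
  \<comment> \<open>Cutting all edges gives the sum \<open>n\<close>, strictly above the bound, so
    the face is proper.\<close>
  show "incidence_vector E \<in> P"
    by (rule inP) (simp add: multicut_iff edge_in_E)
  show "real (Suc (n div 2)) < (\<Sum>e\<in>E. incidence_vector E $ e)"
    using n_ge_5 by (simp add: sum_incidence_vector card_E del: of_nat_Suc)
qed (use assms linear_sum_nth in auto)

lemma defines_shared_facet_sum:
  "defines_shared_facet V E S (\<lambda>x. \<Sum>e\<in>E. x $ e) (real (Suc (n div 2)))"
  unfolding defines_shared_facet_def
  by (intro conjI facet_defining_between convex_multicut_polytope convex_multicut_dominant
      multicut_polytope_subset_dominant order_refl)

end

end

theorem theorem7p1: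
  fixes n :: nat and v :: "nat \<Rightarrow> 'v::finite"
  assumes "n \<ge> 5" and "odd n"
    and "inj_on v {0..<n}"
  shows "defines_shared_facet (cycle_nodes n v) (cycle_edges n v)
           (nonadjacent_pairs (cycle_nodes n v) (cycle_edges n v))
           (\<lambda>x. \<Sum>e\<in>cycle_edges n v. x $ e)
           (real_of_int \<lceil>real n / 2\<rceil>)"
proof -
  interpret cycle_graph n v
    using assms by unfold_locales
  obtain k where k: "n = 2 * k + 1" using \<open>odd n\<close> by (rule oddE)
  \<comment> \<open>Here \<open>n / 2\<close> is \<open>k + 1/2\<close>, and \<open>k\<close> is
    \<open>n div 2\<close>.\<close>
  have "\<lceil>real n / 2\<rceil> = int k + 1"
    by (rule ceiling_unique) (simp_all add: k)
  then have "real_of_int \<lceil>real n / 2\<rceil> = real (Suc (n div 2))"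
    by (simp add: k)
  then show ?thesis
    using defines_shared_facet_sum[OF \<open>odd n\<close>] by simp
qed

end
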